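(* Let $\beta\in\mathbb C$ with $|\beta|>1$ be an algebraic number. Then there exists a finite set $\mathcal A\subset\mathbb Z$ such that $\mathrm{Per}_\mathcal A(\beta)=\mathbb Q(\beta)$.
   Context: For $\beta\in\mathbb C$ with $|\beta|>1$ and a finite alphabet $\mathcal A\subset\mathbb C$, a $(\beta,\mathcal A)$-representation of $x\in\mathbb C$ is an expression $x=\sum_{i=-L}^{+\infty}a_i\beta^{-i}$ with $L\in\mathbb Z$ and all $a_i\in\mathcal A$; it is eventually periodic if the digit sequence $(a_i)_{i\ge -L}$ is eventually periodic. $\mathrm{Per}_\mathcal A(\beta)$ denotes the set of all $x\in\mathbb C$ admitting an eventually periodic $(\beta,\mathcal A)$-representation. *)

theory Defs
  imports
    "HOL-Analysis.Analysis"
    "HOL-Computational_Algebra.Polynomial"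
    "HOL-Algebra.Generated_Fields"
    "HOL-Algebra.Algebraic_Closure_Type"
begin

(* A digit string (a_i) with i >= -L is encoded as a function on all integers whose values
   below -L are never looked at.  The series over i >= -L is reindexed by i = n - L. *)
definition is_representation ::
  "complex \<Rightarrow> complex set \<Rightarrow> int \<Rightarrow> (int \<Rightarrow> complex) \<Rightarrow> complex \<Rightarrow> bool"
where
  "is_representation \<beta> \<A> L a x \<longleftrightarrow>
     (\<forall>i\<ge>-L. a i \<in> \<A>) \<and>
     (\<lambda>n. a (int n - L) * \<beta> powi (- (int n - L))) sums x"

definition eventually_periodic_from :: "int \<Rightarrow> (int \<Rightarrow> complex) \<Rightarrow> bool" where
  "eventually_periodic_from m a \<longleftrightarrow> (\<exists>p>0. \<exists>N\<ge>m. \<forall>i\<ge>N. a (i + p) = a i)"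

definition Per :: "complex set \<Rightarrow> complex \<Rightarrow> complex set" where
  "Per \<A> \<beta> = {x. \<exists>L a. is_representation \<beta> \<A> L a x \<and> eventually_periodic_from (-L) a}"

definition rat_adjoin :: "complex \<Rightarrow> complex set" where
  "rat_adjoin \<beta> = generate_field ring_of_type_algebra (insert \<beta> \<rat>)"

end

(* Let f be a primitive integer polynomial of minimal degree with f(beta) = 0, and let |f| be the
   sum of the absolute values of its coefficients.  The mechanism is rounding: if W = f C + R for
   an integer polynomial W and a real polynomial C, then subtracting f times the coefficientwise
   rounding of C from W leaves an integer polynomial with the same value at beta, whose
   coefficients exceed those of R by at most |f|.

   Given x in Q(beta), write x = y / q with y in Z[beta].  Powers of beta repeat modulo q, so
   x beta^k = z / (beta^p - 1) with z in Z[beta].  As f is coprime to X^p - 1 over Q, rounding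
   modulo X^p - 1 gives x beta^k = P(beta) / (beta^p - 1) + H(beta) with deg P < p and coefficients
   of P bounded by |f|, so the first summand has a purely periodic expansion with digits bounded
   independently of x.  The coefficients of H are not controlled, but for every nonzero f and
   every W the polynomial X^l W is, for a suitable l, congruent modulo f to a complex polynomial
   with arbitrarily small coefficients.  This property is inherited by products, so it only has to
   be checked for linear factors, including those with a root on the unit circle; rounding then
   bounds the digits of H(beta) as well. *)

theory Submission
  imports
    Defs
    "HOL-Computational_Algebra.Polynomial_Factorial"
    "HOL-Computational_Algebra.Field_as_Ring"
    "HOL-Computational_Algebra.Fundamental_Theorem_Algebra"
begin

hide_const (open) Module.smult UnivPoly.coeff UnivPoly.monom Polynomials.degree
  Polynomials.lead_coeff Divisibility.prime

section \<open>Bounded representatives of integer polynomials\<close>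

lemma map_poly_of_int_add [simp]:
  "map_poly (of_int :: int \<Rightarrow> 'a :: ring_1) (p + q) = map_poly of_int p + map_poly of_int q"
  by (rule poly_eqI) (simp add: coeff_map_poly)

lemma map_poly_of_int_diff [simp]:
  "map_poly (of_int :: int \<Rightarrow> 'a :: ring_1) (p - q) = map_poly of_int p - map_poly of_int q"
  by (rule poly_eqI) (simp add: coeff_map_poly)

lemma map_poly_of_int_mult [simp]:
  "map_poly (of_int :: int \<Rightarrow> 'a :: comm_ring_1) (p * q) = map_poly of_int p * map_poly of_int q"
  by (rule poly_eqI) (simp add: coeff_map_poly coeff_mult)

lemma map_poly_of_rat_add [simp]:
  "map_poly (of_rat :: rat \<Rightarrow> 'a :: field_char_0) (p + q) = map_poly of_rat p + map_poly of_rat q"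
  by (rule poly_eqI) (simp add: coeff_map_poly of_rat_add)

lemma map_poly_of_rat_mult [simp]:
  "map_poly (of_rat :: rat \<Rightarrow> 'a :: field_char_0) (p * q) = map_poly of_rat p * map_poly of_rat q"
  by (rule poly_eqI) (simp add: coeff_map_poly coeff_mult of_rat_sum of_rat_mult)

lemma map_poly_of_rat_of_int [simp]:
  "map_poly (of_rat :: rat \<Rightarrow> 'a :: field_char_0) (map_poly of_int p) = map_poly of_int p"
  by (rule poly_eqI) (simp add: coeff_map_poly)

lemma rat_poly_clear_denominators:
  fixes p :: "rat poly"
  obtains d :: int and q :: "int poly" where "d > 0" "map_poly of_int q = smult (of_int d) p"
proof -
  have "\<exists>d q. d > (0::int) \<and> map_poly of_int q = smult (of_int d) p"
  proof (induction p)
    case 0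
    show ?case by (rule exI[of _ 1], rule exI[of _ 0]) simp
  next
    case (pCons a p)
    then obtain d q where dq: "d > (0::int)" "map_poly of_int q = smult (of_int d) p" by blast
    obtain n m where nm: "quotient_of a = (n, m)" by force
    have m: "m > 0" "a = of_int n / of_int m"
      using quotient_of_denom_pos[OF nm] quotient_of_div[OF nm] by auto
    show ?case
    proof (intro exI conjI)
      show "d * m > 0" using dq m by simp
      show "map_poly of_int (pCons (n * d) (smult m q)) = smult (of_int (d * m)) (pCons a p)"
        using m dq by (simp add: map_poly_pCons map_poly_smult mult.commute)
    qed
  qed
  thus ?thesis using that by blast
qed

section \<open>Coefficient estimates for products, plain and cyclic\<close>

lemma degree_X_pow_minus_1: "p > 0 \<Longrightarrow> degree (monom 1 p - 1 :: 'a :: comm_ring_1 poly) = p"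
proof -
  assume "p > 0"
  have "degree (monom 1 p + (- 1) :: 'a poly) = degree (monom 1 p :: 'a poly)"
    by (rule degree_add_eq_left) (use \<open>p > 0\<close> in \<open>simp add: degree_monom_eq\<close>)
  thus ?thesis by (simp add: degree_monom_eq)
qed

text \<open>Multiplication by \<open>X\<close> modulo \<open>X^p - 1\<close> shifts the coefficients
  cyclically and so keeps the bound \<open>b\<close>. Each coefficient \<open>c\<close> of
  \<open>f\<close> therefore contributes at most \<open>\<bar>c\<bar> * b\<close>, independently of
  \<open>p\<close>.\<close>

lemma abs_coeff_mult_mod_X_pow_minus_1_le:
  fixes f E :: "'a :: linordered_field poly"
  assumes "p > 0" and E: "degree E < p" "\<And>i. \<bar>coeff E i\<bar> \<le> b"
  shows "\<bar>coeff ((f * E) mod (monom 1 p - 1)) i\<bar> \<le> (\<Sum>c\<leftarrow>coeffs f. \<bar>c\<bar>) * b"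
proof -
  define M :: "'a poly" where "M = monom 1 p - 1"
  have degM: "degree M = p" unfolding M_def by (rule degree_X_pow_minus_1) fact
  have cM: "coeff M j = (if j = p then 1 else if j = 0 then - 1 else 0)" for j
    using \<open>p > 0\<close> by (auto simp: M_def)
  have M0: "M \<noteq> 0" using degM \<open>p > 0\<close> by auto
  have "0 \<le> \<bar>coeff E 0\<bar>" by simp
  also have "\<dots> \<le> b" by (rule E)
  finally have b: "b \<ge> 0" .
  have "\<forall>i. \<bar>coeff ((f * E) mod M) i\<bar> \<le> (\<Sum>c\<leftarrow>coeffs f. \<bar>c\<bar>) * b"
  proof (induction f)
    case 0
    show ?case by simp
  next
    case (pCons a f)
    define R where "R = (f * E) mod M"
    have degR: "coeff R j = 0" if "j \<ge> p" for j
    proof (rule coeff_eq_0)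
      show "degree R < j"
        unfolding R_def using degree_mod_less[OF M0, of "f * E"] degM \<open>p > 0\<close> that by auto
    qed
    \<comment> \<open>One subtraction of \<open>M\<close> reduces completely because
      \<open>degree R < p\<close>: the coefficient \<open>coeff R (p - 1)\<close> wraps round to the
      constant term.\<close>
    have XR: "pCons 0 (f * E) mod M = pCons 0 R - smult (coeff R (p - 1)) M"
      using \<open>p > 0\<close> by (simp add: mod_pCons M0 degM cM R_def Let_def coeff_pCons split: nat.split)
    have 1: "\<bar>coeff (pCons 0 (f * E) mod M) i\<bar> \<le> (\<Sum>c\<leftarrow>coeffs f. \<bar>c\<bar>) * b" for i
    proof -
      have "coeff (pCons 0 (f * E) mod M) i \<in> insert 0 (range (coeff R))"
        unfolding XR using \<open>p > 0\<close> by (auto simp: cM coeff_pCons degR split: nat.split)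
      moreover have "(\<Sum>c\<leftarrow>coeffs f. \<bar>c\<bar>) * b \<ge> 0"
        using b by (intro mult_nonneg_nonneg sum_list_nonneg) auto
      ultimately show ?thesis using pCons.IH by (auto simp: R_def)
    qed
    have E': "E mod M = E" by (rule mod_poly_less) (use E degM in simp)
    have eq: "(pCons a f * E) mod M = smult a E + pCons 0 (f * E) mod M"
      by (simp add: poly_mod_add_left mod_smult_left E')
    show ?case
    proof
      fix i
      have "\<bar>coeff ((pCons a f * E) mod M) i\<bar> \<le> \<bar>a\<bar> * \<bar>coeff E i\<bar> + \<bar>coeff (pCons 0 (f * E) mod M) i\<bar>"
        unfolding eq by (simp add: abs_mult[symmetric])
      also have "\<dots> \<le> \<bar>a\<bar> * b + (\<Sum>c\<leftarrow>coeffs f. \<bar>c\<bar>) * b"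
        by (intro add_mono mult_left_mono E 1) simp
      also have "\<dots> = (\<Sum>c\<leftarrow>coeffs (pCons a f). \<bar>c\<bar>) * b"
        using pCons.hyps by (simp add: algebra_simps cCons_def)
      finally show "\<bar>coeff ((pCons a f * E) mod M) i\<bar> \<le> (\<Sum>c\<leftarrow>coeffs (pCons a f). \<bar>c\<bar>) * b" .
    qed
  qed
  thus ?thesis by (simp add: M_def)
qed

text \<open>Young's inequality for coefficient sequences, l1 norm against supremum norm, by Horner
  recursion on \<open>f\<close>.\<close>

lemma norm_coeff_mult_le:
  fixes f E :: "'a :: real_normed_field poly"
  assumes E: "\<And>i. norm (coeff E i) \<le> b"
  shows "norm (coeff (f * E) i) \<le> (\<Sum>c\<leftarrow>coeffs f. norm c) * b"
proof (induction f arbitrary: i)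
  case (pCons a f)
  have "norm (coeff (pCons a f * E) i)
      \<le> norm a * norm (coeff E i) + norm (coeff (pCons 0 (f * E)) i)"
    by (simp add: norm_mult[symmetric] norm_triangle_ineq)
  also have "\<dots> \<le> norm a * b + (\<Sum>c\<leftarrow>coeffs f. norm c) * b"
  proof (intro add_mono mult_left_mono E)
    have "0 \<le> norm (coeff E 0)" by simp
    also have "\<dots> \<le> b" by (rule E)
    finally have "(\<Sum>c\<leftarrow>coeffs f. norm c) * b \<ge> 0"
      by (intro mult_nonneg_nonneg sum_list_nonneg) auto
    thus "norm (coeff (pCons 0 (f * E)) i) \<le> (\<Sum>c\<leftarrow>coeffs f. norm c) * b"
      using pCons.IH by (auto simp: coeff_pCons split: nat.split)
  qed simp
  also have "\<dots> = (\<Sum>c\<leftarrow>coeffs (pCons a f). norm c) * b"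
    using pCons.hyps by (simp add: algebra_simps cCons_def)
  finally show ?case .
qed simp

definition small_residuals :: "complex poly \<Rightarrow> bool" where
  "small_residuals f \<longleftrightarrow>
     (\<forall>W. \<forall>\<epsilon>>0. \<exists>k C. \<forall>i. norm (coeff (monom 1 k * W - f * C) i) \<le> \<epsilon>)"

lemma small_residuals_const:
  assumes "c \<noteq> 0"
  shows "small_residuals [:c:]"
  unfolding small_residuals_def
proof (intro allI impI)
  fix W :: "complex poly" and \<epsilon> :: real
  assume "\<epsilon> > 0"
  thus "\<exists>k C. \<forall>i. norm (coeff (monom 1 k * W - [:c:] * C) i) \<le> \<epsilon>"
    using assms by (intro exI[of _ 0] exI[of _ "smult (1 / c) W"]) simp
qed

text \<open>Division in two stages: the quotient of \<open>W\<close> by \<open>f\<close> is itself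
  divided by \<open>g\<close>. The second shift \<open>X^l\<close> moves the coefficients of the
  first residual without changing their size.\<close>

lemma small_residuals_mult:
  assumes f: "small_residuals f" and g: "small_residuals g"
  shows "small_residuals (f * g)"
  unfolding small_residuals_def
proof (intro allI impI)
  fix W :: "complex poly" and \<epsilon> :: real
  assume \<epsilon>: "\<epsilon> > 0"
  define s where "s = (\<Sum>c\<leftarrow>coeffs f. norm c)"
  have s: "s \<ge> 0" unfolding s_def by (intro sum_list_nonneg) auto
  obtain k C where C: "\<And>i. norm (coeff (monom 1 k * W - f * C) i) \<le> \<epsilon> / 2"
    using f \<epsilon> unfolding small_residuals_def by (metis half_gt_zero)
  \<comment> \<open>The residual of the division by \<open>g\<close> enters multiplied by
    \<open>f\<close>, which costs a factor \<open>s\<close>; \<open>s + 1\<close> keeps the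
    denominator positive.\<close>
  have "\<epsilon> / (2 * (s + 1)) > 0" using \<epsilon> s by simp
  then obtain l D where D: "\<And>i. norm (coeff (monom 1 l * C - g * D) i) \<le> \<epsilon> / (2 * (s + 1))"
    using g unfolding small_residuals_def by metis
  have monom_add: "monom (1 :: complex) (k + l) = monom 1 k * monom 1 l"
    by (simp add: mult_monom)
  have eq: "monom 1 (k + l) * W - f * g * D =
      monom 1 l * (monom 1 k * W - f * C) + f * (monom 1 l * C - g * D)"
    by (simp add: monom_add algebra_simps)
  have "norm (coeff (monom 1 (k + l) * W - f * g * D) i) \<le> \<epsilon>" for i
  proof -
    have 1: "norm (coeff (monom 1 l * (monom 1 k * W - f * C)) i) \<le> \<epsilon> / 2"
      using C \<epsilon> by (simp only: coeff_monom_mult) auto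
    have "norm (coeff (f * (monom 1 l * C - g * D)) i) \<le> s * (\<epsilon> / (2 * (s + 1)))"
      using norm_coeff_mult_le[OF D] unfolding s_def .
    also have "\<dots> \<le> \<epsilon> / 2"
      using s \<epsilon> by (simp add: field_simps)
    from norm_triangle_mono[OF 1 order_trans[OF calculation this]] show ?thesis
      unfolding eq coeff_add by simp
  qed
  thus "\<exists>k C. \<forall>i. norm (coeff (monom 1 k * W - f * g * C) i) \<le> \<epsilon>" by blast
qed

text \<open>Only the value of the residual at \<open>a\<close> is prescribed, namely \<open>a ^ k * poly W a\<close>. For
  \<open>norm a < 1\<close> it tends to \<open>0\<close> with \<open>k\<close>; otherwise it is spread evenly over many monomials,
  each of modulus at least \<open>1\<close> at \<open>a\<close>.\<close>

lemma small_residuals_linear: "small_residuals [:- a, 1:]"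
  unfolding small_residuals_def
proof (intro allI impI)
  fix W :: "complex poly" and \<epsilon> :: real
  assume \<epsilon>: "\<epsilon> > 0"
  have "\<exists>k R. poly R a = a ^ k * poly W a \<and> (\<forall>i. norm (coeff R i) \<le> \<epsilon>)"
  proof (cases "norm a < 1")
    case True
    have "(\<lambda>k. norm (a ^ k * poly W a)) \<longlonglongrightarrow> norm (0 * poly W a)"
      by (intro tendsto_intros LIMSEQ_power_zero True)
    hence "eventually (\<lambda>k. norm (a ^ k * poly W a) < \<epsilon>) sequentially"
      by (rule order_tendstoD) (use \<epsilon> in simp)
    then obtain k where k: "norm (a ^ k * poly W a) < \<epsilon>"
      unfolding eventually_sequentially by blast
    show ?thesis
      by (intro exI[of _ k] exI[of _ "[:a ^ k * poly W a:]"])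
         (use k \<epsilon> in \<open>auto simp: coeff_pCons split: nat.split\<close>)
  next
    case False
    obtain K :: nat where K: "norm (poly W a) / \<epsilon> < real K" using reals_Archimedean2 by blast
    have "K > 0" using K \<epsilon> by (metis divide_nonneg_pos gr0I norm_ge_zero not_less of_nat_0)
    have a: "a \<noteq> 0" using False by auto
    define R where "R = (\<Sum>n<K. monom (poly W a / of_nat K * inverse a ^ n) n)"
    have "poly R a = (\<Sum>n<K. poly W a / of_nat K)"
      unfolding R_def poly_sum using a
      by (intro sum.cong) (auto simp: poly_monom field_simps)
    also have "\<dots> = poly W a" using \<open>K > 0\<close> by simp
    finally have R: "poly R a = a ^ 0 * poly W a" by simp
    have "norm (coeff R i) \<le> \<epsilon>" for i
    proof (cases "i < K")
      case True
      have "coeff R i = poly W a / of_nat K * inverse a ^ i"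
        unfolding R_def coeff_sum using True by (simp add: sum.delta)
      hence "norm (coeff R i) = norm (poly W a) / real K * inverse (norm a) ^ i"
        by (simp add: norm_mult norm_divide norm_power norm_inverse)
      also have "\<dots> \<le> norm (poly W a) / real K * 1"
        using False by (intro mult_left_mono power_le_one) (auto intro: inverse_le_1_iff[THEN iffD2])
      also have "\<dots> \<le> \<epsilon>" using K \<epsilon> \<open>K > 0\<close> by (simp add: field_simps)
      finally show ?thesis .
    next
      case False
      hence "coeff R i = 0" unfolding R_def coeff_sum by (simp add: sum.delta)
      thus ?thesis using \<epsilon> by simp
    qed
    thus ?thesis using R by blast
  qed
  then obtain k R where R: "poly R a = a ^ k * poly W a" "\<And>i. norm (coeff R i) \<le> \<epsilon>" by blast
  have "poly (monom 1 k * W - R) a = 0" using R by (simp add: poly_monom)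
  then obtain C where "monom 1 k * W - R = [:- a, 1:] * C"
    unfolding poly_eq_0_iff_dvd by (elim dvdE)
  hence "monom 1 k * W - [:- a, 1:] * C = R" by (simp add: algebra_simps)
  thus "\<exists>k C. \<forall>i. norm (coeff (monom 1 k * W - [:- a, 1:] * C) i) \<le> \<epsilon>"
    using R(2) by metis
qed

text \<open>Roots are split off one at a time until a nonzero constant is left.\<close>

lemma small_residuals_nonzero:
  assumes "f \<noteq> 0"
  shows "small_residuals f"
  using assms
proof (induction "degree f" arbitrary: f)
  case 0
  then obtain c where "f = [:c:]" by (metis degree_eq_zeroE)
  thus ?case using 0 small_residuals_const by auto
next
  case (Suc n)
  hence "\<not> constant (poly f)" by (simp add: constant_degree)
  then obtain a where "poly f a = 0" using fundamental_theorem_of_algebra by blast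
  then obtain g where g: "f = [:- a, 1:] * g" unfolding poly_eq_0_iff_dvd by (elim dvdE)
  have "g \<noteq> 0" using g Suc.prems by auto
  moreover from this have "degree f = Suc (degree g)"
    unfolding g by (subst degree_mult_eq) auto
  ultimately have "small_residuals g" using Suc by simp
  thus ?case unfolding g by (intro small_residuals_mult small_residuals_linear)
qed

text \<open>Multiplication by an integer polynomial commutes with taking real parts, so the
  imaginary parts of \<open>E\<close>, which rounding does not control, are harmless.\<close>

lemma abs_Re_coeff_of_int_mult_le:
  fixes f :: "int poly" and E :: "complex poly"
  assumes E: "\<And>i. \<bar>Re (coeff E i)\<bar> \<le> 1"
  shows "\<bar>Re (coeff (map_poly of_int f * E) i)\<bar> \<le> (\<Sum>c\<leftarrow>coeffs f. real_of_int \<bar>c\<bar>)"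
proof (induction f arbitrary: i)
  case (pCons a f)
  have nn: "0 \<le> (\<Sum>c\<leftarrow>coeffs f. real_of_int \<bar>c\<bar>)"
    by (intro sum_list_nonneg) auto
  have "\<bar>Re (coeff (map_poly of_int (pCons a f) * E) i)\<bar>
      \<le> \<bar>real_of_int a\<bar> * \<bar>Re (coeff E i)\<bar> + \<bar>Re (coeff (pCons 0 (map_poly of_int f * E)) i)\<bar>"
    by (simp add: map_poly_pCons abs_mult[symmetric])
  also have "\<dots> \<le> \<bar>real_of_int a\<bar> * 1 + (\<Sum>c\<leftarrow>coeffs f. real_of_int \<bar>c\<bar>)"
    using pCons.IH nn
    by (intro add_mono mult_left_mono E) (auto simp: coeff_pCons split: nat.split)
  also have "\<dots> = (\<Sum>c\<leftarrow>coeffs (pCons a f). real_of_int \<bar>c\<bar>)"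
    using pCons.hyps by (simp add: cCons_def)
  finally show ?case .
qed simp

text \<open>A complex quotient with residual at most \<open>1\<close> is replaced by the rounding of
  its real parts. The summand \<open>1\<close> pays for the residual, the coefficient sum of
  \<open>f\<close> for the rounding.\<close>

lemma bounded_representative_shift:
  fixes f W :: "int poly"
  assumes "f \<noteq> 0"
  obtains k C where "\<And>i. \<bar>coeff (monom 1 k * W - f * C) i\<bar> \<le> (\<Sum>c\<leftarrow>coeffs f. \<bar>c\<bar>) + 1"
proof -
  let ?c = "map_poly of_int :: int poly \<Rightarrow> complex poly"
  have "?c f \<noteq> 0" using assms by (simp add: map_poly_eq_0_iff)
  hence "small_residuals (?c f)" by (rule small_residuals_nonzero)
  then obtain k D where D: "\<And>i. norm (coeff (monom 1 k * ?c W - ?c f * D) i) \<le> 1"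
    unfolding small_residuals_def by (metis zero_less_one)
  define C where "C = map_poly (\<lambda>z. round (Re z)) D"
  define N where "N = monom 1 k * W - f * C"
  have cN: "?c N = (monom 1 k * ?c W - ?c f * D) + ?c f * (D - ?c C)"
    by (simp add: N_def map_poly_monom algebra_simps)
  have "\<bar>Re (coeff (D - ?c C) i)\<bar> \<le> 1" for i
    using of_int_round_abs_le[of "Re (coeff D i)"]
    by (simp add: C_def coeff_map_poly abs_minus_commute)
  hence 2: "\<bar>Re (coeff (?c f * (D - ?c C)) i)\<bar> \<le> (\<Sum>c\<leftarrow>coeffs f. real_of_int \<bar>c\<bar>)" for i
    by (rule abs_Re_coeff_of_int_mult_le)
  have 1: "\<bar>Re (coeff (monom 1 k * ?c W - ?c f * D) i)\<bar> \<le> 1" for i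
    using D abs_Re_le_cmod order_trans by blast
  have "\<bar>coeff N i\<bar> \<le> (\<Sum>c\<leftarrow>coeffs f. \<bar>c\<bar>) + 1" for i
  proof -
    have "real_of_int \<bar>coeff N i\<bar> = \<bar>Re (coeff (?c N) i)\<bar>"
      by (simp add: coeff_map_poly)
    also have "\<dots> \<le> 1 + (\<Sum>c\<leftarrow>coeffs f. real_of_int \<bar>c\<bar>)"
      unfolding cN coeff_add plus_complex.sel
      by (rule order_trans[OF abs_triangle_ineq add_mono[OF 1 2]])
    also have "(\<Sum>c\<leftarrow>coeffs f. real_of_int \<bar>c\<bar>) = real_of_int (\<Sum>c\<leftarrow>coeffs f. \<bar>c\<bar>)"
      by (simp add: o_def flip: sum_list_of_int)
    finally show ?thesis by linarith
  qed
  thus ?thesis using that unfolding N_def by blast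
qed

text \<open>The Bezout identity makes \<open>f\<close> invertible modulo \<open>X^p - 1\<close> over
  the rationals, so \<open>W\<close> is congruent to \<open>f * D\<close> with \<open>D\<close>
  rational of degree below \<open>p\<close>. Rounding \<open>D\<close> to \<open>C\<close> leaves
  the residual \<open>f * (D - C)\<close>, which the cyclic estimate bounds.\<close>

lemma bounded_representative_mod:
  fixes f W :: "int poly" and u v :: "rat poly"
  assumes "p > 0" and uv: "u * map_poly of_int f + v * (monom 1 p - 1) = 1"
  obtains C H P where "W = f * C + (monom 1 p - 1) * H + P" "degree P < p"
    "\<And>i. \<bar>coeff P i\<bar> \<le> (\<Sum>c\<leftarrow>coeffs f. \<bar>c\<bar>)"
proof -
  let ?r = "map_poly of_int :: int poly \<Rightarrow> rat poly"
  define M :: "int poly" where "M = monom 1 p - 1"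
  \<comment> \<open>As \<open>u\<close> is the inverse of \<open>f\<close> modulo
    \<open>X^p - 1\<close>, this is \<open>W / f\<close> in the quotient ring.\<close>
  define D where "D = (?r W * u) mod ?r M"
  have rM: "?r M = monom 1 p - 1" by (simp add: M_def map_poly_monom)
  have degM: "degree M = p" "degree (?r M) = p" "M \<noteq> 0" "?r M \<noteq> 0"
    using degree_X_pow_minus_1[OF \<open>p > 0\<close>, where 'a=int]
      degree_X_pow_minus_1[OF \<open>p > 0\<close>, where 'a=rat] \<open>p > 0\<close> rM by (auto simp: M_def)
  have lead: "lead_coeff M = 1" using \<open>p > 0\<close> unfolding degM(1) by (simp add: M_def)
  have "(?r f * D) mod ?r M = (?r W * (u * ?r f)) mod ?r M"
    unfolding D_def by (simp add: mod_mult_right_eq ac_simps)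
  also have "u * ?r f = 1 - v * ?r M" using uv unfolding rM by (simp add: eq_diff_eq)
  also have "(?r W * (1 - v * ?r M)) mod ?r M = ?r W mod ?r M"
    by (simp add: right_diff_distrib flip: mult.assoc) (metis mod_mult_self4 diff_conv_add_uminus mult_minus_left mod_mult_self2 mult.commute)
  finally have D: "(?r f * D) mod ?r M = ?r W mod ?r M" .
  define C where "C = map_poly round D"
  define E where "E = D - ?r C"
  have degD: "coeff D i = 0" if "i \<ge> p" for i
    using degree_mod_less[OF degM(4), of "?r W * u"] degM that \<open>p > 0\<close>
    by (intro coeff_eq_0) (auto simp: D_def)
  have cE: "coeff E i = coeff D i - of_int (round (coeff D i))" for i
    by (simp add: E_def C_def coeff_map_poly)
  have absE: "\<bar>coeff E i\<bar> \<le> 1" for i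
    unfolding cE using of_int_round_abs_le[of "coeff D i"] by (simp add: abs_minus_commute)
  have degE: "degree E < p"
    by (rule degree_lessI) (use degD cE \<open>p > 0\<close> in auto)
  define N where "N = W - f * C"
  \<comment> \<open>\<open>M\<close> is monic, so pseudo-division is ordinary division with integer
    quotient and remainder.\<close>
  obtain H P where pd: "pseudo_divmod N M = (H, P)" by force
  have N: "N = M * H + P" and P: "degree P < p"
    using pseudo_divmod[OF degM(3) pd] lead degM(1) \<open>p > 0\<close> by auto
  have "?r P mod ?r M = ?r P"
    using P degM by (intro mod_poly_less) (simp add: degree_map_poly)
  hence "?r P = ?r N mod ?r M"
    unfolding N by (simp add: mod_add_cong)
  also have "\<dots> = (?r W - ?r f * ?r C) mod ?r M" by (simp add: N_def)
  also have "\<dots> = (?r f * D - ?r f * ?r C) mod ?r M"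
    using D by (metis mod_diff_left_eq)
  also have "\<dots> = (?r f * E) mod (monom 1 p - 1)"
    by (simp add: E_def right_diff_distrib rM)
  finally have P': "?r P = (?r f * E) mod (monom 1 p - 1)" .
  have "\<bar>coeff P i\<bar> \<le> (\<Sum>c\<leftarrow>coeffs f. \<bar>c\<bar>)" for i
  proof -
    have "rat_of_int \<bar>coeff P i\<bar> = \<bar>coeff (?r P) i\<bar>" by (simp add: coeff_map_poly)
    also have "\<dots> \<le> (\<Sum>c\<leftarrow>coeffs (?r f). \<bar>c\<bar>) * 1"
      unfolding P' by (rule abs_coeff_mult_mod_X_pow_minus_1_le) fact+
    also have "\<dots> = of_int (\<Sum>c\<leftarrow>coeffs f. \<bar>c\<bar>)"
      by (simp add: coeffs_map_poly' o_def flip: sum_list_of_int)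
    finally show ?thesis by linarith
  qed
  moreover have "W = f * C + (monom 1 p - 1) * H + P"
    using N by (simp add: N_def M_def algebra_simps)
  ultimately show ?thesis using P that by blast
qed

section \<open>Denominators in number fields\<close>

text \<open>The primitive part of an annihilating polynomial of least degree. Content
  \<open>1\<close> later ensures that \<open>f\<close> does not vanish modulo any prime.\<close>

lemma exists_minimal_int_poly:
  fixes \<beta> :: complex
  assumes "Polynomial.algebraic \<beta>"
  obtains f :: "int poly" where "f \<noteq> 0" "content f = 1" "poly (map_poly of_int f) \<beta> = 0"
    "\<And>g :: int poly. g \<noteq> 0 \<Longrightarrow> poly (map_poly of_int g) \<beta> = 0 \<Longrightarrow> degree f \<le> degree g"
proof -
  define R where "R = (\<lambda>g :: int poly. g \<noteq> 0 \<and> poly (map_poly of_int g) \<beta> = 0)"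
  obtain p :: "complex poly" where p: "\<And>i. coeff p i \<in> \<int>" "p \<noteq> 0" "poly p \<beta> = 0"
    using assms unfolding Polynomial.algebraic_def by blast
  obtain q where "p = map_poly of_int q" using p(1) by (rule intpolyE)
  with p have "R q" by (auto simp: R_def)
  then obtain g where g: "R g" "\<And>h. R h \<Longrightarrow> degree g \<le> degree h"
    using ex_has_least_nat[of R q degree] by blast
  have "map_poly of_int g = smult (of_int (content g)) (map_poly of_int (primitive_part g) :: complex poly)"
    by (subst (1) content_times_primitive_part[of g, symmetric]) (simp only: map_poly_smult of_int_0 of_int_mult)
  hence "poly (map_poly of_int (primitive_part g)) \<beta> = 0"
    using g(1) by (auto simp: R_def)
  thus ?thesis using that[of "primitive_part g"] g by (auto simp: R_def)
qed

text \<open>The gcd of \<open>f\<close> and \<open>Q\<close> divides \<open>Q\<close> and hence does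
  not vanish at \<open>\<beta>\<close>, so the cofactor of the gcd in \<open>f\<close> does. By
  minimality the cofactor has full degree and the gcd is constant.\<close>

lemma bezout_minimal_int_poly:
  fixes \<beta> :: complex and f :: "int poly" and Q :: "rat poly"
  assumes f: "f \<noteq> 0" "poly (map_poly of_int f) \<beta> = 0"
    and min: "\<And>g :: int poly. g \<noteq> 0 \<Longrightarrow> poly (map_poly of_int g) \<beta> = 0 \<Longrightarrow> degree f \<le> degree g"
    and Q: "poly (map_poly of_rat Q) \<beta> \<noteq> 0"
  obtains u v where "u * map_poly of_int f + v * Q = 1"
proof -
  define F :: "rat poly" where "F = map_poly of_int f"
  have F: "F \<noteq> 0" "degree F = degree f"
    using f by (auto simp: F_def map_poly_eq_0_iff degree_map_poly)
  define g where "g = gcd F Q"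
  obtain u v where uv: "u * F + v * Q = g"
    unfolding g_def using bezout_coefficients_fst_snd by metis
  obtain h where h: "F = g * h" unfolding g_def by (meson dvdE gcd_dvd1)
  obtain k where k: "Q = g * k" unfolding g_def by (meson dvdE gcd_dvd2)
  have "poly (map_poly of_rat g) \<beta> \<noteq> 0" using Q by (auto simp: k)
  moreover have "poly (map_poly of_rat F) \<beta> = 0" using f by (simp add: F_def)
  ultimately have h0: "poly (map_poly of_rat h) \<beta> = 0" by (simp add: h)
  obtain d q where dq: "d > 0" "map_poly of_int q = smult (of_int d) h"
    by (rule rat_poly_clear_denominators)
  have "g \<noteq> 0" "h \<noteq> 0" using F h by auto
  have "degree q = degree (map_poly rat_of_int q)" by (simp add: degree_map_poly)
  hence dgq: "degree q = degree h" using dq by simp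
  have "(map_poly of_int q :: complex poly) = map_poly of_rat (map_poly rat_of_int q)" by simp
  also have "\<dots> = smult (of_int d) (map_poly of_rat h)"
    unfolding dq by (subst map_poly_smult) (auto simp: of_rat_mult)
  finally have "poly (map_poly of_int q) \<beta> = 0" using h0 by simp
  moreover have "q \<noteq> 0" using dq \<open>h \<noteq> 0\<close> by auto
  ultimately have "degree F \<le> degree h" using min[of q] F dgq by simp
  hence "degree g = 0" using h \<open>g \<noteq> 0\<close> \<open>h \<noteq> 0\<close> by (simp add: degree_mult_eq)
  then obtain c where c: "g = [:c:]" by (rule degree_eq_zeroE)
  have "c \<noteq> 0" using c \<open>g \<noteq> 0\<close> by auto
  have "smult (1 / c) u * F + smult (1 / c) v * Q = smult (1 / c) (u * F + v * Q)"
    by (simp add: smult_add_right)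
  also have "\<dots> = 1" unfolding uv c using \<open>c \<noteq> 0\<close> by simp
  finally show ?thesis using that unfolding F_def by blast
qed

section \<open>The ring Z[beta] and powers of beta modulo an integer\<close>

definition int_adjoin :: "complex \<Rightarrow> complex set" where
  "int_adjoin \<beta> = range (\<lambda>p. poly (map_poly of_int p) \<beta>)"

lemma int_adjoinI: "x = poly (map_poly of_int p) \<beta> \<Longrightarrow> x \<in> int_adjoin \<beta>"
  by (auto simp: int_adjoin_def)

lemma int_adjoin_add: "x \<in> int_adjoin \<beta> \<Longrightarrow> y \<in> int_adjoin \<beta> \<Longrightarrow> x + y \<in> int_adjoin \<beta>"
  unfolding int_adjoin_def by (auto simp flip: poly_add map_poly_of_int_add)

lemma int_adjoin_mult: "x \<in> int_adjoin \<beta> \<Longrightarrow> y \<in> int_adjoin \<beta> \<Longrightarrow> x * y \<in> int_adjoin \<beta>"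
  unfolding int_adjoin_def by (auto simp flip: poly_mult map_poly_of_int_mult)

lemma int_adjoin_of_int: "of_int n \<in> int_adjoin \<beta>"
  by (rule int_adjoinI[of _ "[:n:]"]) (simp add: map_poly_pCons)

lemma int_adjoin_numeric: "0 \<in> int_adjoin \<beta>" "1 \<in> int_adjoin \<beta>" "of_nat n \<in> int_adjoin \<beta>"
  using int_adjoin_of_int[of 0] int_adjoin_of_int[of 1] int_adjoin_of_int[of "int n"] by auto

lemma int_adjoin_diff: "x \<in> int_adjoin \<beta> \<Longrightarrow> y \<in> int_adjoin \<beta> \<Longrightarrow> x - y \<in> int_adjoin \<beta>"
  using int_adjoin_add[OF _ int_adjoin_mult[OF int_adjoin_of_int[of "-1"]], of x \<beta> y] by simp

lemma int_adjoin_generator: "\<beta> \<in> int_adjoin \<beta>"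
  by (rule int_adjoinI[of _ "[:0, 1:]"]) (simp add: map_poly_pCons)

lemma int_adjoin_power: "x \<in> int_adjoin \<beta> \<Longrightarrow> x ^ n \<in> int_adjoin \<beta>"
  by (induction n) (auto intro: int_adjoin_numeric int_adjoin_mult)

lemma int_adjoin_sum: "(\<And>i. i \<in> A \<Longrightarrow> g i \<in> int_adjoin \<beta>) \<Longrightarrow> sum g A \<in> int_adjoin \<beta>"
  by (induction A rule: infinite_finite_induct) (auto intro: int_adjoin_numeric int_adjoin_add)

lemmas int_adjoin_closed = int_adjoin_add int_adjoin_mult int_adjoin_of_int int_adjoin_numeric
  int_adjoin_diff int_adjoin_generator int_adjoin_power int_adjoin_sum

text \<open>A primitive polynomial stays nonzero modulo \<open>q\<close>, so modulo \<open>q\<close> only finitely many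
  classes contain powers of its root.\<close>

lemma int_adjoin_power_cong_prime:
  assumes "prime (q :: nat)" and f: "content f = 1" "poly (map_poly of_int f) \<beta> = 0"
  shows "\<exists>k p. p > 0 \<and> (\<exists>z\<in>int_adjoin \<beta>. \<beta> ^ k * (\<beta> ^ p - 1) = of_nat q * z)"
proof -
  have "q > 1" using assms(1) by (rule prime_gt_1_nat)
  define J where "J = {i. \<not> int q dvd coeff f i}"
  have "J \<noteq> {}"
  proof
    assume "J = {}"
    hence "[:int q:] dvd f" by (auto simp: J_def const_poly_dvd_iff)
    hence "int q dvd 1" using f(1) const_poly_dvd_iff_dvd_content by metis
    thus False using \<open>q > 1\<close> by simp
  qed
  have "J \<subseteq> {..degree f}"
    unfolding J_def by (auto intro!: le_degree)
  hence "finite J" by (rule finite_subset) simp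
  \<comment> \<open>The degree of \<open>f\<close> modulo \<open>q\<close>.\<close>
  define m where "m = Max J"
  have mJ: "m \<in> J" unfolding m_def by (rule Max_in) fact+
  have gt_m: "int q dvd coeff f i" if "i > m" for i
    using Max_ge[OF \<open>finite J\<close>, of i] that by (auto simp: m_def J_def)
  \<comment> \<open>The integer span of the first \<open>m\<close> powers of \<open>\<beta>\<close>,
    enlarged by all multiples of \<open>q\<close> in Z[beta]. It turns out to contain every power of
    \<open>\<beta>\<close>.\<close>
  define S where "S = {x. \<exists>c z. z \<in> int_adjoin \<beta> \<and> x = (\<Sum>i<m. of_int (c i) * \<beta> ^ i) + of_nat q * z}"
  have S_add: "x + y \<in> S" if "x \<in> S" "y \<in> S" for x y
  proof -
    obtain c z where "z \<in> int_adjoin \<beta>" "x = (\<Sum>i<m. of_int (c i) * \<beta> ^ i) + of_nat q * z"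
      using \<open>x \<in> S\<close> unfolding S_def by blast
    moreover obtain d w where "w \<in> int_adjoin \<beta>" "y = (\<Sum>i<m. of_int (d i) * \<beta> ^ i) + of_nat q * w"
      using \<open>y \<in> S\<close> unfolding S_def by blast
    ultimately show ?thesis unfolding S_def
      by (intro CollectI exI[of _ "\<lambda>i. c i + d i"] exI[of _ "z + w"] conjI int_adjoin_add)
         (auto simp: algebra_simps sum.distrib)
  qed
  have S_scale: "of_int a * x \<in> S" if "x \<in> S" for a x
  proof -
    obtain c z where "z \<in> int_adjoin \<beta>" "x = (\<Sum>i<m. of_int (c i) * \<beta> ^ i) + of_nat q * z"
      using \<open>x \<in> S\<close> unfolding S_def by blast
    thus ?thesis unfolding S_def
      by (intro CollectI exI[of _ "\<lambda>i. a * c i"] exI[of _ "of_int a * z"] conjI int_adjoin_closed)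
         (auto simp: algebra_simps sum_distrib_left)
  qed
  have S_q: "of_nat q * z \<in> S" if "z \<in> int_adjoin \<beta>" for z
    unfolding S_def using that by (intro CollectI exI[of _ "\<lambda>_. 0"] exI[of _ z]) simp
  have S_0: "0 \<in> S" using S_q[OF int_adjoin_numeric(1)] by simp
  have S_low: "\<beta> ^ i \<in> S" if "i < m" for i
    unfolding S_def using that
    by (intro CollectI exI[of _ "\<lambda>j. if j = i then 1 else 0"] exI[of _ 0])
       (auto simp: int_adjoin_numeric if_distrib[of "\<lambda>x. of_int x * _"] sum.delta cong: if_cong)
  have S_sum: "sum g A \<in> S" if "\<And>i. i \<in> A \<Longrightarrow> g i \<in> S" for g :: "nat \<Rightarrow> complex" and A
    using that by (induction A rule: infinite_finite_induct) (auto intro: S_0 S_add)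
  \<comment> \<open>Modulo \<open>q\<close>, the terms of \<open>f\<close> above \<open>m\<close>
    vanish and the coefficient at \<open>m\<close> is invertible, so the relation for
    \<open>f\<close> expresses \<open>\<beta> ^ m\<close> by lower powers.\<close>
  have S_m: "\<beta> ^ m \<in> S"
  proof -
    have "of_int (coeff f i) * \<beta> ^ i \<in> S" if "i \<noteq> m" for i
    proof (cases "i < m")
      case True
      thus ?thesis by (intro S_scale S_low)
    next
      case False
      with that obtain t where t: "coeff f i = int q * t" using gt_m[of i] by (auto elim: dvdE)
      have "of_nat q * (of_int t * \<beta> ^ i) \<in> S" by (intro S_q int_adjoin_closed)
      thus ?thesis by (simp add: t mult_ac)
    qed
    hence S1: "of_int (-1) * (\<Sum>i\<in>{..degree f} - {m}. of_int (coeff f i) * \<beta> ^ i) \<in> S"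
      by (intro S_scale[OF S_sum]) blast
    have "(\<Sum>i\<le>degree f. of_int (coeff f i) * \<beta> ^ i) = 0"
      using f(2) by (simp add: poly_altdef degree_map_poly coeff_map_poly)
    moreover have "m \<le> degree f" using mJ \<open>J \<subseteq> _\<close> by auto
    ultimately have "of_int (coeff f m) * \<beta> ^ m =
        of_int (-1) * (\<Sum>i\<in>{..degree f} - {m}. of_int (coeff f i) * \<beta> ^ i)"
      by (simp add: sum.remove[of _ m] add_eq_0_iff2)
    hence S2: "of_int (coeff f m) * \<beta> ^ m \<in> S" using S1 by simp
    have "coprime (int q) (coeff f m)"
      using mJ assms(1) by (auto simp: J_def intro!: prime_imp_coprime)
    then obtain a b where ab: "a * int q + b * coeff f m = 1"
      using bezout_int[of "int q" "coeff f m"] by auto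
    have "\<beta> ^ m = of_int (a * int q + b * coeff f m) * \<beta> ^ m" unfolding ab by simp
    also have "\<dots> = of_nat q * (of_int a * \<beta> ^ m) + of_int b * (of_int (coeff f m) * \<beta> ^ m)"
      by (simp add: algebra_simps)
    also have "\<dots> \<in> S" by (intro S_add S_scale S_q S2 int_adjoin_closed)
    finally show ?thesis .
  qed
  have S_gen: "\<beta> * x \<in> S" if "x \<in> S" for x
  proof -
    obtain c z where z: "z \<in> int_adjoin \<beta>" "x = (\<Sum>i<m. of_int (c i) * \<beta> ^ i) + of_nat q * z"
      using \<open>x \<in> S\<close> unfolding S_def by blast
    have "\<beta> ^ Suc i \<in> S" if "i < m" for i
      using S_low[of "Suc i"] S_m that by (cases "Suc i = m") auto
    hence "(\<Sum>i<m. of_int (c i) * \<beta> ^ Suc i) + of_nat q * (\<beta> * z) \<in> S"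
      using z by (intro S_add S_sum S_scale S_q int_adjoin_closed) auto
    thus ?thesis unfolding z(2) by (simp add: algebra_simps sum_distrib_left)
  qed
  have "\<beta> ^ n \<in> S" for n
  proof (induction n)
    case 0
    show ?case using S_low[of 0] S_m by (cases "m = 0") auto
  qed (auto intro: S_gen)
  hence "\<exists>c z. z \<in> int_adjoin \<beta> \<and> \<beta> ^ n = (\<Sum>i<m. of_int (c i) * \<beta> ^ i) + of_nat q * z" for n
    unfolding S_def by blast
  then obtain c z where cz: "\<And>n. z n \<in> int_adjoin \<beta>"
    "\<And>n. \<beta> ^ n = (\<Sum>i<m. of_int (c n i) * \<beta> ^ i) + of_nat q * z n" by metis
  \<comment> \<open>Pigeonhole on the coefficient vectors modulo \<open>q\<close>; restricting them
    to \<open>{..<m}\<close> places them in a finite set of extensional functions.\<close>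
  define r where "r n = (\<lambda>i\<in>{..<m}. c n i mod int q)" for n
  have "range r \<subseteq> {..<m} \<rightarrow>\<^sub>E {0..<int q}"
    using \<open>q > 1\<close> by (auto simp: r_def split: if_splits)
  hence "finite (range r)" by (rule finite_subset) (intro finite_PiE, auto)
  hence "\<not> inj r" using finite_imageD infinite_UNIV_nat by blast
  then obtain k n where kn: "r k = r n" "k < n"
    unfolding inj_def by (metis nat_neq_iff)
  have "\<exists>t. c n i - c k i = int q * t" if "i < m" for i
  proof -
    have "c n i mod int q = c k i mod int q"
      using fun_cong[OF kn(1), of i] that by (simp add: r_def)
    thus ?thesis by (metis dvdE mod_eq_dvd_iff)
  qed
  then obtain t where t: "\<And>i. i < m \<Longrightarrow> c n i - c k i = int q * t i" by metis
  have "\<beta> ^ k * (\<beta> ^ (n - k) - 1) = \<beta> ^ n - \<beta> ^ k"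
    using kn(2) by (simp add: algebra_simps flip: power_add)
  also have "\<dots> = (\<Sum>i<m. of_int (c n i - c k i) * \<beta> ^ i) + of_nat q * (z n - z k)"
    unfolding cz(2)[of n] cz(2)[of k] by (simp add: algebra_simps sum_subtractf)
  also have "(\<Sum>i<m. of_int (c n i - c k i) * \<beta> ^ i) = (\<Sum>i<m. of_nat q * (of_int (t i) * \<beta> ^ i))"
    by (intro sum.cong refl) (simp add: t mult_ac)
  also have "\<dots> + of_nat q * (z n - z k) = of_nat q * ((\<Sum>i<m. of_int (t i) * \<beta> ^ i) + (z n - z k))"
    by (simp add: algebra_simps sum_distrib_left)
  finally have "\<beta> ^ k * (\<beta> ^ (n - k) - 1) =
    of_nat q * ((\<Sum>i<m. of_int (t i) * \<beta> ^ i) + (z n - z k))" .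
  moreover have "(\<Sum>i<m. of_int (t i) * \<beta> ^ i) + (z n - z k) \<in> int_adjoin \<beta>"
    by (intro int_adjoin_closed cz)
  moreover have "n - k > 0" using kn(2) by simp
  ultimately show ?thesis by blast
qed

text \<open>If \<open>Y\<close> is \<open>1\<close> modulo both \<open>a\<close> and \<open>b\<close>, then \<open>Y ^ b - 1\<close> is \<open>Y - 1\<close> times a geometric sum
  of \<open>b\<close> terms that are \<open>1\<close> modulo \<open>b\<close>, hence divisible by \<open>a * b\<close>.\<close>

lemma int_adjoin_power_cong_mult:
  assumes a: "p > 0" "x \<in> int_adjoin \<beta>" "\<beta> ^ k * (\<beta> ^ p - 1) = of_nat a * x"
    and b: "r > 0" "y \<in> int_adjoin \<beta>" "\<beta> ^ l * (\<beta> ^ r - 1) = of_nat b * y" and "b > 0"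
  shows "\<exists>k p. p > 0 \<and> (\<exists>z\<in>int_adjoin \<beta>. \<beta> ^ k * (\<beta> ^ p - 1) = of_nat (a * b) * z)"
proof -
  \<comment> \<open>The exponent \<open>p * r\<close> serves both congruences, as
    \<open>\<beta> ^ p - 1\<close> and \<open>\<beta> ^ r - 1\<close> both divide
    \<open>Y - 1\<close>.\<close>
  define Y where "Y = \<beta> ^ (p * r)"
  have Y: "Y \<in> int_adjoin \<beta>" unfolding Y_def by (intro int_adjoin_closed)
  have geo: "w ^ n - 1 = (w - 1) * (\<Sum>i<n. w ^ i)" for w :: complex and n
    by (rule power_diff_1_eq)
  define x' where "x' = x * (\<Sum>i<r. (\<beta> ^ p) ^ i)"
  define y' where "y' = y * (\<Sum>i<p. (\<beta> ^ r) ^ i)"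
  have x': "x' \<in> int_adjoin \<beta>" "\<beta> ^ k * (Y - 1) = of_nat a * x'"
    unfolding x'_def Y_def using a
    by (auto intro!: int_adjoin_closed simp: power_mult geo[of "\<beta> ^ p"] simp flip: mult.assoc)
  have Y_alt: "Y = (\<beta> ^ r) ^ p" by (simp add: Y_def mult.commute flip: power_mult)
  have y': "y' \<in> int_adjoin \<beta>" "\<beta> ^ l * (Y - 1) = of_nat b * y'"
    unfolding y'_def Y_alt using b
    by (auto intro!: int_adjoin_closed simp: geo[of "\<beta> ^ r"] simp flip: mult.assoc)
  \<comment> \<open>Collects the cofactors of \<open>Y - 1\<close> in \<open>Y ^ i - 1\<close>, so
    that the geometric sum equals \<open>b\<close> modulo \<open>Y - 1\<close>.\<close>
  define T where "T = (\<Sum>i<b. \<Sum>j<i. Y ^ j)"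
  have T: "T \<in> int_adjoin \<beta>" unfolding T_def by (intro int_adjoin_closed Y)
  have "(\<Sum>i<b. Y ^ i) = (\<Sum>i<b. 1 + (Y - 1) * (\<Sum>j<i. Y ^ j))"
    by (simp flip: geo)
  also have "\<dots> = of_nat b + (Y - 1) * T"
    by (simp add: sum.distrib T_def sum_distrib_left)
  finally have sum_Y: "(\<Sum>i<b. Y ^ i) = of_nat b + (Y - 1) * T" .
  have "\<beta> ^ (k + l) * (Y ^ b - 1) = (\<beta> ^ k * (Y - 1)) * (\<beta> ^ l * (\<Sum>i<b. Y ^ i))"
    by (simp add: geo[of Y b] power_add mult_ac)
  also have "\<dots> = (\<beta> ^ k * (Y - 1)) * (\<beta> ^ l * of_nat b + (\<beta> ^ l * (Y - 1)) * T)"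
    unfolding sum_Y by (simp only: distrib_left mult.assoc)
  also have "\<dots> = of_nat (a * b) * (x' * (\<beta> ^ l + y' * T))"
    unfolding x' y' by (simp add: algebra_simps)
  finally have "\<beta> ^ (k + l) * (\<beta> ^ (p * r * b) - 1) = of_nat (a * b) * (x' * (\<beta> ^ l + y' * T))"
    by (simp add: Y_def power_mult)
  moreover have "x' * (\<beta> ^ l + y' * T) \<in> int_adjoin \<beta>"
    by (intro int_adjoin_closed x' y' T)
  moreover have "p * r * b > 0" using a b \<open>b > 0\<close> by simp
  ultimately show ?thesis by blast
qed

text \<open>Induction on the prime factors of \<open>q\<close>. Primes come first because a
  primitive polynomial such as \<open>2 X + 3\<close> may have no unit coefficient modulo a
  composite number, here \<open>6\<close>.\<close>

lemma int_adjoin_power_cong: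
  assumes "q > 0" and f: "content f = 1" "poly (map_poly of_int f) \<beta> = 0"
  shows "\<exists>k p. p > 0 \<and> (\<exists>z\<in>int_adjoin \<beta>. \<beta> ^ k * (\<beta> ^ p - 1) = of_nat q * z)"
  using assms(1)
proof (induction q rule: prime_divisors_induct)
  case (unit q)
  thus ?case
    by (intro exI[of _ 0] exI[of _ 1] conjI bexI[of _ "\<beta> - 1"]) (auto intro!: int_adjoin_closed)
next
  case (factor q n)
  then have "n > 0" by simp
  with factor.IH obtain l r y where b: "r > 0" "y \<in> int_adjoin \<beta>"
    "\<beta> ^ l * (\<beta> ^ r - 1) = of_nat n * y" by blast
  obtain k p x where a: "p > 0" "x \<in> int_adjoin \<beta>" "\<beta> ^ k * (\<beta> ^ p - 1) = of_nat q * x"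
    using int_adjoin_power_cong_prime[OF factor(1) f] by blast
  show ?case by (rule int_adjoin_power_cong_mult[OF a b \<open>n > 0\<close>])
qed simp

section \<open>Eventually periodic expansions\<close>

text \<open>Expansions starting at \<open>\<beta> ^ 0\<close>, with integer digits, can be added
  digit by digit. The free starting index is recovered later by multiplying with a power of
  \<open>\<beta>\<close>.\<close>

definition periodic_sums :: "complex \<Rightarrow> int \<Rightarrow> complex set" where
  "periodic_sums \<beta> B = {x. \<exists>b. (\<forall>n. \<bar>b n\<bar> \<le> B) \<and> (\<exists>p>0. \<exists>N. \<forall>n\<ge>N. b (n + p) = b n) \<and>
     (\<lambda>n. of_int (b n) * inverse \<beta> ^ n) sums x}"

lemma periodic_sumsI:
  fixes b :: "nat \<Rightarrow> int"
  assumes "\<And>n. \<bar>b n\<bar> \<le> B" "p > 0" "\<And>n. n \<ge> N \<Longrightarrow> b (n + p) = b n"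
    "(\<lambda>n. of_int (b n) * inverse \<beta> ^ n) sums x"
  shows "x \<in> periodic_sums \<beta> B"
  using assms unfolding periodic_sums_def by blast

lemma eventually_periodic_add_mult:
  fixes b :: "nat \<Rightarrow> 'a"
  assumes "\<And>n. n \<ge> N \<Longrightarrow> b (n + p) = b n" "n \<ge> N"
  shows "b (n + k * p) = b n"
proof (induction k)
  case (Suc k)
  have "b (n + Suc k * p) = b ((n + k * p) + p)" by (simp add: algebra_simps)
  also have "\<dots> = b n" using assms Suc by simp
  finally show ?case .
qed simp

text \<open>Digits are added without carries, so the bounds add up; \<open>p * q\<close> is a common
  period.\<close>

lemma periodic_sums_add:
  assumes "x \<in> periodic_sums \<beta> B" "y \<in> periodic_sums \<beta> C"
  shows "x + y \<in> periodic_sums \<beta> (B + C)"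
proof -
  obtain b p N where b: "\<And>n. \<bar>b n\<bar> \<le> B" "p > 0" "\<And>n. n \<ge> N \<Longrightarrow> b (n + p) = b n"
    "(\<lambda>n. of_int (b n) * inverse \<beta> ^ n) sums x"
    using assms(1) unfolding periodic_sums_def by blast
  obtain c q M where c: "\<And>n. \<bar>c n\<bar> \<le> C" "q > 0" "\<And>n. n \<ge> M \<Longrightarrow> c (n + q) = c n"
    "(\<lambda>n. of_int (c n) * inverse \<beta> ^ n) sums y"
    using assms(2) unfolding periodic_sums_def by blast
  show ?thesis
  proof (rule periodic_sumsI[where b = "\<lambda>n. b n + c n" and p = "p * q" and N = "max N M"])
    show "\<bar>b n + c n\<bar> \<le> B + C" for n
      using b(1)[of n] c(1)[of n] by linarith
    show "b (n + p * q) + c (n + p * q) = b n + c n" if "n \<ge> max N M" for n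
      using eventually_periodic_add_mult[of N b p n q] eventually_periodic_add_mult[of M c q n p]
        b(3) c(3) that by (simp add: mult.commute)
    show "(\<lambda>n. of_int (b n + c n) * inverse \<beta> ^ n) sums (x + y)"
      using sums_add[OF b(4) c(4)] by (simp add: algebra_simps)
  qed (use b c in simp)
qed

text \<open>Each factor \<open>inverse \<beta>\<close> prepends a digit \<open>0\<close>.\<close>

lemma periodic_sums_mult_inverse_power:
  assumes "x \<in> periodic_sums \<beta> B"
  shows "x * inverse \<beta> ^ k \<in> periodic_sums \<beta> B"
proof (induction k)
  case (Suc k)
  define y where "y = x * inverse \<beta> ^ k"
  obtain b p N where b: "\<And>n. \<bar>b n\<bar> \<le> B" "p > 0" "\<And>n. n \<ge> N \<Longrightarrow> b (n + p) = b n"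
    "(\<lambda>n. of_int (b n) * inverse \<beta> ^ n) sums y"
    using Suc unfolding periodic_sums_def y_def by blast
  define c where "c n = (case n of 0 \<Rightarrow> 0 | Suc n \<Rightarrow> b n)" for n
  have "inverse \<beta> * y \<in> periodic_sums \<beta> B"
  proof (rule periodic_sumsI)
    show "\<bar>c n\<bar> \<le> B" for n
      using b(1) order_trans[OF abs_ge_zero b(1)] by (auto simp: c_def split: nat.split)
    show "c (n + p) = c n" if "n \<ge> Suc N" for n
      using b(3)[of "n - 1"] that by (cases n) (auto simp: c_def)
    have "(\<lambda>n. inverse \<beta> * (of_int (b n) * inverse \<beta> ^ n)) sums (inverse \<beta> * y)"
      by (intro sums_mult b)
    hence "(\<lambda>n. of_int (c (Suc n)) * inverse \<beta> ^ Suc n) sums (inverse \<beta> * y)"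
      by (simp add: c_def mult_ac)
    thus "(\<lambda>n. of_int (c n) * inverse \<beta> ^ n) sums (inverse \<beta> * y)"
      by (subst (asm) sums_Suc_iff) (simp add: c_def)
  qed fact
  thus ?case by (simp add: y_def mult_ac)
qed (use assms in simp)

text \<open>Dropping the first \<open>p\<close> terms multiplies the series by \<open>r\<close>.
  This evaluates the periodic expansions constructed below and also shows that values of periodic
  expansions lie in the field.\<close>

lemma quasi_geometric_sum:
  fixes g :: "nat \<Rightarrow> 'a :: real_normed_field"
  assumes "g sums x" "\<And>n. g (n + p) = r * g n"
  shows "x * (1 - r) = (\<Sum>n<p. g n)"
proof -
  have "(\<lambda>n. g (n + p)) sums (x - (\<Sum>n<p. g n))"
    using assms(1) by (simp add: sums_iff_shift)
  moreover have "(\<lambda>n. g (n + p)) sums (r * x)"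
    unfolding assms(2) by (intro sums_mult assms)
  ultimately have "x - (\<Sum>n<p. g n) = r * x" by (rule sums_unique2)
  thus ?thesis by (simp add: algebra_simps)
qed

text \<open>A finite expansion continues with the digit \<open>0\<close>, which has period
  \<open>1\<close>.\<close>

lemma poly_inverse_in_periodic_sums:
  assumes "\<And>i. \<bar>coeff Q i\<bar> \<le> B"
  shows "poly (map_poly of_int Q) (inverse \<beta>) \<in> periodic_sums \<beta> B"
proof (rule periodic_sumsI[where p = 1 and N = "Suc (degree Q)"])
  have "(\<lambda>n. of_int (coeff Q n) * inverse \<beta> ^ n) sums
      (\<Sum>n\<le>degree Q. of_int (coeff Q n) * inverse \<beta> ^ n)"
    by (rule sums_finite) (auto simp: coeff_eq_0)
  also have "(\<Sum>n\<le>degree Q. of_int (coeff Q n) * inverse \<beta> ^ n) =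
      poly (map_poly of_int Q) (inverse \<beta>)"
    by (simp add: poly_altdef coeff_map_poly degree_map_poly)
  finally show "(\<lambda>n. of_int (coeff Q n) * inverse \<beta> ^ n) sums \<dots>" .
qed (use assms in \<open>auto simp: coeff_eq_0\<close>)

text \<open>Repeating the coefficients of \<open>Q\<close>, padded with zeros to length
  \<open>p\<close>, gives a geometric series of ratio \<open>inverse \<beta> ^ p\<close>.\<close>

lemma poly_inverse_div_in_periodic_sums:
  assumes \<beta>: "norm \<beta> > 1" and "\<And>i. \<bar>coeff Q i\<bar> \<le> B" "degree Q < p"
  shows "poly (map_poly of_int Q) (inverse \<beta>) / (1 - inverse \<beta> ^ p) \<in> periodic_sums \<beta> B"
proof (rule periodic_sumsI[where b = "\<lambda>n. coeff Q (n mod p)" and p = p and N = 0])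
  define g :: "nat \<Rightarrow> complex" where "g = (\<lambda>n. of_int (coeff Q (n mod p)) * inverse \<beta> ^ n)"
  have w: "norm (inverse \<beta>) < 1" using \<beta> by (simp add: norm_inverse inverse_less_1_iff)
  have "p > 0" using assms by simp
  have "summable (\<lambda>n. of_int B * norm (inverse \<beta>) ^ n)"
    using w by (intro summable_mult summable_geometric) simp
  hence "summable g"
  proof (rule summable_comparison_test')
    fix n :: nat
    have "real_of_int \<bar>coeff Q (n mod p)\<bar> \<le> real_of_int B" using assms by (simp only: of_int_le_iff)
    hence "norm (of_int (coeff Q (n mod p)) :: complex) \<le> of_int B" by simp
    thus "norm (g n) \<le> of_int B * norm (inverse \<beta>) ^ n"
      unfolding g_def norm_mult norm_power by (intro mult_right_mono) auto
  qed
  then obtain S where S: "g sums S" unfolding summable_def by blast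
  have "S * (1 - inverse \<beta> ^ p) = (\<Sum>n<p. g n)"
    by (rule quasi_geometric_sum[OF S]) (simp add: g_def power_add mult_ac)
  also have "\<dots> = (\<Sum>n<p. of_int (coeff Q n) * inverse \<beta> ^ n)"
    by (intro sum.cong) (auto simp: g_def)
  also have "\<dots> = (\<Sum>n\<le>degree Q. of_int (coeff Q n) * inverse \<beta> ^ n)"
    using assms(3) by (intro sum.mono_neutral_right) (auto simp: coeff_eq_0)
  also have "\<dots> = poly (map_poly of_int Q) (inverse \<beta>)"
    by (simp add: poly_altdef coeff_map_poly degree_map_poly)
  finally have "S * (1 - inverse \<beta> ^ p) = poly (map_poly of_int Q) (inverse \<beta>)" .
  moreover have "norm (inverse \<beta> ^ p) < 1"
    using w \<open>p > 0\<close> unfolding norm_power by (simp add: power_less_one_iff)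
  hence "1 - inverse \<beta> ^ p \<noteq> 0" by auto
  ultimately have "S = poly (map_poly of_int Q) (inverse \<beta>) / (1 - inverse \<beta> ^ p)"
    by (simp add: field_simps)
  thus "(\<lambda>n. of_int (coeff Q (n mod p)) * inverse \<beta> ^ n) sums
      (poly (map_poly of_int Q) (inverse \<beta>) / (1 - inverse \<beta> ^ p))"
    using S by (simp add: g_def)
qed (use assms in auto)

lemma abs_coeff_reflect_poly_le:
  fixes P :: "int poly"
  assumes "\<And>i. \<bar>coeff P i\<bar> \<le> B"
  shows "\<bar>coeff (reflect_poly P) i\<bar> \<le> B"
  using assms order_trans[OF abs_ge_zero assms] by (auto simp: coeff_reflect_poly)

lemma poly_reflect_poly_of_int:
  fixes \<beta> :: complex
  assumes "\<beta> \<noteq> 0"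
  shows "poly (map_poly of_int (reflect_poly P)) (inverse \<beta>) =
    poly (map_poly of_int P) \<beta> * inverse \<beta> ^ degree P"
proof -
  have "map_poly of_int (reflect_poly P) = reflect_poly (map_poly of_int P :: complex poly)"
    by (rule poly_eqI) (simp add: coeff_map_poly coeff_reflect_poly degree_map_poly)
  thus ?thesis
    using assms by (simp add: poly_reflect_poly_nz degree_map_poly mult.commute)
qed

text \<open>Reversing the coefficients turns a polynomial in \<open>\<beta>\<close> into one in
  \<open>inverse \<beta>\<close>, up to \<open>\<beta> ^ degree P\<close>; the surplus
  \<open>n - degree P\<close> becomes leading zeros.\<close>

lemma poly_in_periodic_sums:
  assumes "\<beta> \<noteq> 0" "\<And>i. \<bar>coeff P i\<bar> \<le> B" "n \<ge> degree P"
  shows "poly (map_poly of_int P) \<beta> * inverse \<beta> ^ n \<in> periodic_sums \<beta> B"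
proof -
  have "poly (map_poly of_int P) \<beta> * inverse \<beta> ^ degree P * inverse \<beta> ^ (n - degree P) \<in> periodic_sums \<beta> B"
    unfolding poly_reflect_poly_of_int[OF assms(1), symmetric]
    by (intro periodic_sums_mult_inverse_power poly_inverse_in_periodic_sums abs_coeff_reflect_poly_le assms)
  thus ?thesis using assms(3) by (simp add: mult.assoc flip: power_add)
qed

text \<open>Writing \<open>\<beta> ^ p - 1\<close> as
  \<open>\<beta> ^ p * (1 - inverse \<beta> ^ p)\<close> leaves \<open>inverse \<beta> ^ p\<close>
  for the numerator: \<open>degree P\<close> of these factors reverse \<open>P\<close>, the others
  prepend zeros.\<close>

lemma poly_div_in_periodic_sums:
  assumes \<beta>: "norm \<beta> > 1" and "\<And>i. \<bar>coeff P i\<bar> \<le> B" "degree P < p"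
  shows "poly (map_poly of_int P) \<beta> / (\<beta> ^ p - 1) \<in> periodic_sums \<beta> B"
proof -
  have [simp]: "\<beta> \<noteq> 0" using \<beta> by auto
  have "degree (reflect_poly P) < p" using degree_reflect_poly_le[of P] assms(3) by simp
  hence "poly (map_poly of_int P) \<beta> * inverse \<beta> ^ degree P / (1 - inverse \<beta> ^ p) *
      inverse \<beta> ^ (p - degree P) \<in> periodic_sums \<beta> B"
    unfolding poly_reflect_poly_of_int[OF \<open>\<beta> \<noteq> 0\<close>, symmetric]
    by (intro periodic_sums_mult_inverse_power poly_inverse_div_in_periodic_sums abs_coeff_reflect_poly_le assms)
  also have "poly (map_poly of_int P) \<beta> * inverse \<beta> ^ degree P / (1 - inverse \<beta> ^ p) *
      inverse \<beta> ^ (p - degree P) = poly (map_poly of_int P) \<beta> *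
      (inverse \<beta> ^ degree P * inverse \<beta> ^ (p - degree P)) / (1 - inverse \<beta> ^ p)"
    by simp
  also have "inverse \<beta> ^ degree P * inverse \<beta> ^ (p - degree P) = inverse \<beta> ^ p"
    using assms(3) by (simp flip: power_add)
  also have "poly (map_poly of_int P) \<beta> * inverse \<beta> ^ p / (1 - inverse \<beta> ^ p) =
      poly (map_poly of_int P) \<beta> / (\<beta> ^ p - 1)"
  proof -
    have "1 - inverse \<beta> ^ p = (\<beta> ^ p - 1) * inverse \<beta> ^ p"
      by (simp add: algebra_simps flip: power_mult_distrib)
    thus ?thesis by simp
  qed
  finally show ?thesis .
qed

section \<open>The field generated by the base\<close>

lemma ring_of_type_algebra_simps:
  fixes x y :: complex
  shows "x \<oplus>\<^bsub>ring_of_type_algebra\<^esub> y = x + y" "x \<otimes>\<^bsub>ring_of_type_algebra\<^esub> y = x * y"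
    "\<ominus>\<^bsub>ring_of_type_algebra\<^esub> x = - x" "x \<noteq> 0 \<Longrightarrow> inv\<^bsub>ring_of_type_algebra\<^esub> x = inverse x"
    "\<zero>\<^bsub>ring_of_type_algebra\<^esub> = (0 :: complex)" "\<one>\<^bsub>ring_of_type_algebra\<^esub> = (1 :: complex)"
proof -
  interpret K: Ring.field "ring_of_type_algebra :: complex ring"
    by (rule field_from_type_algebra)
  show "x \<oplus>\<^bsub>ring_of_type_algebra\<^esub> y = x + y" "x \<otimes>\<^bsub>ring_of_type_algebra\<^esub> y = x * y"
    "\<zero>\<^bsub>ring_of_type_algebra\<^esub> = (0 :: complex)" "\<one>\<^bsub>ring_of_type_algebra\<^esub> = (1 :: complex)"
    by (simp_all add: ring_of_type_algebra_def)
  show "\<ominus>\<^bsub>ring_of_type_algebra\<^esub> x = - x"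
    by (rule K.minus_equality) (simp_all add: ring_of_type_algebra_def)
  show "inv\<^bsub>ring_of_type_algebra\<^esub> x = inverse x" if "x \<noteq> 0"
    by (rule K.comm_inv_char) (use that in \<open>simp_all add: ring_of_type_algebra_def\<close>)
qed

lemma rat_adjoin_generator: "\<beta> \<in> rat_adjoin \<beta>"
  unfolding rat_adjoin_def by (rule generate_field.incl) simp

lemma rat_adjoin_Rats: "x \<in> \<rat> \<Longrightarrow> x \<in> rat_adjoin \<beta>"
  unfolding rat_adjoin_def by (rule generate_field.incl) simp

lemma rat_adjoin_add: "x \<in> rat_adjoin \<beta> \<Longrightarrow> y \<in> rat_adjoin \<beta> \<Longrightarrow> x + y \<in> rat_adjoin \<beta>"
  unfolding rat_adjoin_def by (metis generate_field.eng_add ring_of_type_algebra_simps(1))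

lemma rat_adjoin_mult: "x \<in> rat_adjoin \<beta> \<Longrightarrow> y \<in> rat_adjoin \<beta> \<Longrightarrow> x * y \<in> rat_adjoin \<beta>"
  unfolding rat_adjoin_def by (metis generate_field.eng_mult ring_of_type_algebra_simps(2))

lemma rat_adjoin_uminus: "x \<in> rat_adjoin \<beta> \<Longrightarrow> - x \<in> rat_adjoin \<beta>"
  unfolding rat_adjoin_def by (metis generate_field.a_inv ring_of_type_algebra_simps(3))

lemma rat_adjoin_inverse: "x \<in> rat_adjoin \<beta> \<Longrightarrow> inverse x \<in> rat_adjoin \<beta>"
  using generate_field.m_inv[of x ring_of_type_algebra "insert \<beta> \<rat>"]
  \<comment> \<open>\<open>generate_field\<close> provides inverses of nonzero elements only; at
    \<open>0\<close> the value \<open>inverse 0 = 0\<close> is rational.\<close>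
  by (cases "x = 0") (auto simp: ring_of_type_algebra_simps rat_adjoin_Rats simp flip: rat_adjoin_def)

lemma rat_adjoin_diff: "x \<in> rat_adjoin \<beta> \<Longrightarrow> y \<in> rat_adjoin \<beta> \<Longrightarrow> x - y \<in> rat_adjoin \<beta>"
  using rat_adjoin_add[OF _ rat_adjoin_uminus] by fastforce

lemma rat_adjoin_divide: "x \<in> rat_adjoin \<beta> \<Longrightarrow> y \<in> rat_adjoin \<beta> \<Longrightarrow> x / y \<in> rat_adjoin \<beta>"
  unfolding divide_inverse by (intro rat_adjoin_mult rat_adjoin_inverse)

lemma rat_adjoin_sum: "(\<And>i. i \<in> A \<Longrightarrow> g i \<in> rat_adjoin \<beta>) \<Longrightarrow> sum g A \<in> rat_adjoin \<beta>"
  by (induction A rule: infinite_finite_induct) (auto intro: rat_adjoin_Rats rat_adjoin_add)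

lemma rat_adjoin_power: "x \<in> rat_adjoin \<beta> \<Longrightarrow> x ^ n \<in> rat_adjoin \<beta>"
  by (induction n) (auto intro: rat_adjoin_Rats rat_adjoin_mult)

lemma rat_adjoin_powi: "x \<in> rat_adjoin \<beta> \<Longrightarrow> x powi n \<in> rat_adjoin \<beta>"
  by (auto simp: power_int_def intro: rat_adjoin_power rat_adjoin_inverse)

text \<open>Beyond an initial segment, shifting by the period multiplies the terms by
  \<open>r = \<beta> powi (- p)\<close>. The value is thus a rational expression in \<open>r\<close>
  and finitely many terms, all of which lie in the field.\<close>

lemma Per_subset_rat_adjoin:
  assumes \<beta>: "norm \<beta> > 1" and "\<A> \<subseteq> \<int>"
  shows "Per \<A> \<beta> \<subseteq> rat_adjoin \<beta>"
proof
  fix x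
  assume "x \<in> Per \<A> \<beta>"
  then obtain L a p N where a: "\<And>i. i \<ge> -L \<Longrightarrow> a i \<in> \<A>"
    and sums: "(\<lambda>n. a (int n - L) * \<beta> powi (- (int n - L))) sums x"
    and per: "p > 0" "N \<ge> -L" "\<And>i. i \<ge> N \<Longrightarrow> a (i + p) = a i"
    unfolding Per_def is_representation_def eventually_periodic_from_def by blast
  have "\<beta> \<noteq> 0" using \<beta> by auto
  define g where "g = (\<lambda>n. a (int n - L) * \<beta> powi (- (int n - L)))"
  have gK: "g n \<in> rat_adjoin \<beta>" for n
  proof -
    have "a (int n - L) \<in> \<rat>" using a[of "int n - L"] assms(2) Ints_subset_Rats by auto
    thus ?thesis unfolding g_def
      by (intro rat_adjoin_mult rat_adjoin_powi rat_adjoin_Rats rat_adjoin_generator)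
  qed
  \<comment> \<open>\<open>N\<close> is a digit position \<open>i\<close>; \<open>M\<close> is the
    matching summation index \<open>n = i + L\<close>.\<close>
  define M where "M = nat (N + L)"
  define r where "r = \<beta> powi (- p)"
  have step: "g (n + nat p + M) = r * g (n + M)" for n
  proof -
    have "int (n + nat p + M) - L = (int (n + M) - L) + p" using per by simp
    moreover have "a ((int (n + M) - L) + p) = a (int (n + M) - L)"
      using per by (intro per(3)) (simp add: M_def)
    moreover have "\<beta> powi (- ((int (n + M) - L) + p)) = r * \<beta> powi (- (int (n + M) - L))"
      using \<open>\<beta> \<noteq> 0\<close> by (simp add: r_def flip: power_int_add)
    ultimately show ?thesis by (simp only: g_def mult_ac)
  qed
  have "(\<lambda>n. g (n + M)) sums (x - (\<Sum>n<M. g n))"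
    using sums unfolding g_def by (rule sums_split_initial_segment)
  hence "(x - (\<Sum>n<M. g n)) * (1 - r) = (\<Sum>n<nat p. g (n + M))"
    by (rule quasi_geometric_sum) (rule step)
  moreover have "norm r < 1"
  proof -
    have "norm r = inverse (norm \<beta> ^ nat p)"
      using per by (simp add: r_def power_int_def norm_power norm_inverse power_inverse)
    moreover have "norm \<beta> ^ nat p > 1" using \<beta> per by (simp add: one_less_power)
    ultimately show ?thesis by (simp add: inverse_less_1_iff)
  qed
  hence "1 - r \<noteq> 0" by auto
  ultimately have "x = (\<Sum>n<M. g n) + (\<Sum>n<nat p. g (n + M)) / (1 - r)"
    by (simp add: field_simps)
  also have "\<dots> \<in> rat_adjoin \<beta>"
    unfolding r_def
    by (intro rat_adjoin_add rat_adjoin_divide rat_adjoin_diff rat_adjoin_sum rat_adjoin_powi gK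
        rat_adjoin_generator) (simp add: rat_adjoin_Rats)
  finally show "x \<in> rat_adjoin \<beta>" .
qed

text \<open>Only inverses need more than ring operations: for \<open>h = Q(\<beta>)\<close> nonzero,
  the Bezout identity evaluated at \<open>\<beta>\<close> reads
  \<open>v(\<beta>) * h = 1\<close>.\<close>

lemma rat_adjoin_imp_poly:
  fixes f :: "int poly"
  assumes f: "f \<noteq> 0" "poly (map_poly of_int f) \<beta> = 0"
    and min: "\<And>g :: int poly. g \<noteq> 0 \<Longrightarrow> poly (map_poly of_int g) \<beta> = 0 \<Longrightarrow> degree f \<le> degree g"
    and "x \<in> rat_adjoin \<beta>"
  shows "\<exists>Q. x = poly (map_poly of_rat Q) \<beta>"
  using assms(4) unfolding rat_adjoin_def
proof (induction rule: generate_field.induct)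
  case one
  show ?case by (rule exI[of _ 1]) (simp add: ring_of_type_algebra_simps)
next
  case (incl h)
  thus ?case
  proof
    assume "h = \<beta>"
    thus ?thesis by (intro exI[of _ "[:0, 1:]"]) (simp add: map_poly_pCons)
  next
    assume "h \<in> \<rat>"
    then obtain r where "h = of_rat r" by (rule Rats_cases)
    thus ?thesis by (intro exI[of _ "[:r:]"]) (simp add: map_poly_pCons)
  qed
next
  case (a_inv h)
  then obtain Q where Q: "h = poly (map_poly of_rat Q) \<beta>" by blast
  have "poly (map_poly of_rat ([:- 1:] * Q)) \<beta> = - h"
    unfolding map_poly_of_rat_mult Q by (simp add: map_poly_pCons of_rat_minus)
  thus ?case by (metis ring_of_type_algebra_simps(3))
next
  case (m_inv h)
  then obtain Q where Q: "h = poly (map_poly of_rat Q) \<beta>" by blast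
  have h: "h \<noteq> 0" using m_inv by (simp add: ring_of_type_algebra_simps)
  obtain u v where uv: "u * map_poly of_int f + v * Q = 1"
    by (rule bezout_minimal_int_poly[OF f min, of Q]) (use h Q in auto)
  have "poly (map_poly of_rat (u * map_poly of_int f + v * Q)) \<beta> = (1 :: complex)"
    unfolding uv by simp
  hence "poly (map_poly of_rat v) \<beta> * h = 1" using f Q by simp
  hence "inverse h = poly (map_poly of_rat v) \<beta>" using h by (simp add: field_simps)
  thus ?case using h by (auto simp: ring_of_type_algebra_simps)
next
  case (eng_add x y)
  thus ?case by (metis map_poly_of_rat_add poly_add ring_of_type_algebra_simps(1))
next
  case (eng_mult x y)
  thus ?case by (metis map_poly_of_rat_mult poly_mult ring_of_type_algebra_simps(2))
qed

lemma periodic_sums_imp_Per: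
  assumes "x * inverse \<beta> ^ m \<in> periodic_sums \<beta> B" and "\<beta> \<noteq> 0"
  shows "x \<in> Per (of_int ` {-B..B}) \<beta>"
proof -
  obtain b p N where b: "\<And>n. \<bar>b n\<bar> \<le> B" "p > 0" "\<And>n. n \<ge> N \<Longrightarrow> b (n + p) = b n"
    "(\<lambda>n. of_int (b n) * inverse \<beta> ^ n) sums (x * inverse \<beta> ^ m)"
    using assms(1) unfolding periodic_sums_def by blast
  \<comment> \<open>The representation has \<open>L = m\<close>; for positions below
    \<open>- int m\<close>, which are never inspected, \<open>nat\<close> repeats the first
    digit.\<close>
  define a :: "int \<Rightarrow> complex" where "a i = of_int (b (nat (i + int m)))" for i
  have "(\<lambda>n. of_int (b n) * inverse \<beta> ^ n * \<beta> ^ m) sums (x * inverse \<beta> ^ m * \<beta> ^ m)"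
    by (intro sums_mult2 b)
  also have "x * inverse \<beta> ^ m * \<beta> ^ m = x"
    using assms(2) by (simp add: mult.assoc flip: power_mult_distrib)
  also have "(\<lambda>n. of_int (b n) * inverse \<beta> ^ n * \<beta> ^ m) =
      (\<lambda>n. a (int n - int m) * \<beta> powi (- (int n - int m)))"
    using assms(2) by (auto simp: a_def power_int_diff power_inverse field_simps)
  finally have "(\<lambda>n. a (int n - int m) * \<beta> powi (- (int n - int m))) sums x" .
  moreover have "\<forall>i\<ge>-int m. a i \<in> of_int ` {-B..B}"
    using b(1) by (auto simp: a_def abs_le_iff intro!: imageI) (metis minus_le_iff)
  moreover have "eventually_periodic_from (- int m) a"
    unfolding eventually_periodic_from_def
  proof (intro exI conjI allI impI)
    fix i :: int
    assume i: "i \<ge> int N - int m"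
    hence "nat (i + int p + int m) = nat (i + int m) + p" by simp
    thus "a (i + int p) = a i" using b(3)[of "nat (i + int m)"] i by (simp add: a_def)
  qed (use b in auto)
  ultimately show ?thesis unfolding Per_def is_representation_def by blast
qed

text \<open>In the digit bound, \<open>s\<close> comes from the periodic part \<open>P\<close> and
  \<open>s + 1\<close> from the representative of \<open>H\<close>. Both depend on \<open>f\<close>
  alone, so one alphabet serves every \<open>x\<close>.\<close>

lemma rat_adjoin_imp_periodic_sums:
  fixes f :: "int poly"
  assumes \<beta>: "norm \<beta> > 1" and f: "f \<noteq> 0" "content f = 1" "poly (map_poly of_int f) \<beta> = 0"
    and min: "\<And>g :: int poly. g \<noteq> 0 \<Longrightarrow> poly (map_poly of_int g) \<beta> = 0 \<Longrightarrow> degree f \<le> degree g"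
    and x: "x \<in> rat_adjoin \<beta>"
  defines "s \<equiv> (\<Sum>c\<leftarrow>coeffs f. \<bar>c\<bar>)"
  shows "\<exists>m. x * inverse \<beta> ^ m \<in> periodic_sums \<beta> (s + (s + 1))"
proof -
  have "\<beta> \<noteq> 0" using \<beta> by auto
  obtain Q where Q: "x = poly (map_poly of_rat Q) \<beta>"
    using rat_adjoin_imp_poly[OF f(1,3) min x] by blast
  obtain d Y where d: "d > 0" "map_poly of_int Y = smult (of_int d) Q"
    by (rule rat_poly_clear_denominators)
  have "poly (map_poly of_int Y) \<beta> = poly (map_poly of_rat (map_poly rat_of_int Y)) \<beta>" by simp
  also have "\<dots> = of_int d * x"
    unfolding d Q by (subst map_poly_smult) (auto simp: of_rat_mult)
  finally have Y: "poly (map_poly of_int Y) \<beta> = of_int d * x" .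
  obtain k p z where p: "p > 0" and z: "z \<in> int_adjoin \<beta>"
    "\<beta> ^ k * (\<beta> ^ p - 1) = of_nat (nat d) * z"
    using int_adjoin_power_cong[of "nat d", OF _ f(2,3)] d by auto
  have "norm (\<beta> ^ p) > 1" using \<beta> p by (simp add: norm_power one_less_power)
  hence p1: "\<beta> ^ p - 1 \<noteq> 0" by auto
  \<comment> \<open>The denominator \<open>d\<close> of \<open>x\<close> is traded for
    \<open>\<beta> ^ p - 1\<close>: this product is \<open>x * (d * z)\<close>, and
    \<open>d * z\<close> equals \<open>\<beta> ^ k * (\<beta> ^ p - 1)\<close>.\<close>
  have "poly (map_poly of_int Y) \<beta> * z \<in> int_adjoin \<beta>"
    by (intro int_adjoin_mult z int_adjoinI) simp
  then obtain W where "poly (map_poly of_int Y) \<beta> * z = poly (map_poly of_int W) \<beta>"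
    unfolding int_adjoin_def by blast
  hence W: "poly (map_poly of_int W) \<beta> = x * \<beta> ^ k * (\<beta> ^ p - 1)"
    using z d unfolding Y by (simp add: mult_ac)
  have eval_X_pow: "poly (map_poly of_rat (monom 1 p - 1)) \<beta> = \<beta> ^ p - 1"
  proof -
    have "(map_poly of_rat (monom 1 p - 1) :: complex poly) = monom 1 p - 1"
      by (rule poly_eqI) (simp add: coeff_map_poly of_rat_diff)
    thus ?thesis by (simp add: poly_monom)
  qed
  obtain u v :: "rat poly" where "u * map_poly of_int f + v * (monom 1 p - 1) = 1"
    by (rule bezout_minimal_int_poly[OF f(1,3), of "monom 1 p - 1"])
       (use min p1 eval_X_pow in auto)
  then obtain C H P where CHP: "W = f * C + (monom 1 p - 1) * H + P" "degree P < p"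
    "\<And>i. \<bar>coeff P i\<bar> \<le> s"
    unfolding s_def by (rule bounded_representative_mod[OF p, of _ f]) blast
  have "poly (map_poly of_int W) \<beta> =
      (\<beta> ^ p - 1) * poly (map_poly of_int H) \<beta> + poly (map_poly of_int P) \<beta>"
    unfolding CHP(1) using f by (simp add: map_poly_monom poly_monom)
  hence x1: "x * \<beta> ^ k = poly (map_poly of_int P) \<beta> / (\<beta> ^ p - 1) + poly (map_poly of_int H) \<beta>"
    unfolding W using p1 by (simp add: field_simps)
  obtain l D where D: "\<And>i. \<bar>coeff (monom 1 l * H - f * D) i\<bar> \<le> s + 1"
    using bounded_representative_shift[OF f(1), of H] unfolding s_def by blast
  define R where "R = monom 1 l * H - f * D"
  have R: "poly (map_poly of_int R) \<beta> = \<beta> ^ l * poly (map_poly of_int H) \<beta>"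
    unfolding R_def using f by (simp add: map_poly_monom poly_monom)
  have shift_k: "\<beta> ^ k * inverse \<beta> ^ (k + n) = inverse \<beta> ^ n" for k n
    using \<open>\<beta> \<noteq> 0\<close> by (simp add: power_add flip: mult.assoc power_mult_distrib)
  define n where "n = degree R"
  \<comment> \<open>The second summand carries \<open>l\<close> more inverse powers because the
    value of \<open>R\<close> at \<open>\<beta>\<close> already contains \<open>\<beta> ^ l\<close>;
    \<open>n = degree R\<close> leaves no positive powers of \<open>\<beta>\<close> there.\<close>
  have "poly (map_poly of_int P) \<beta> / (\<beta> ^ p - 1) * inverse \<beta> ^ (l + n) +
      poly (map_poly of_int R) \<beta> * inverse \<beta> ^ (l + (l + n)) \<in> periodic_sums \<beta> (s + (s + 1))"
    using D by (intro periodic_sums_add periodic_sums_mult_inverse_power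
        poly_div_in_periodic_sums poly_in_periodic_sums \<beta> \<open>\<beta> \<noteq> 0\<close> CHP) (auto simp: R_def n_def)
  also have "poly (map_poly of_int R) \<beta> * inverse \<beta> ^ (l + (l + n)) =
      poly (map_poly of_int H) \<beta> * inverse \<beta> ^ (l + n)"
    unfolding R by (simp only: mult.commute[of "\<beta> ^ l"] mult.assoc shift_k)
  also have "poly (map_poly of_int P) \<beta> / (\<beta> ^ p - 1) * inverse \<beta> ^ (l + n) + \<dots> =
      x * \<beta> ^ k * inverse \<beta> ^ (l + n)"
    unfolding x1 by (simp only: distrib_right)
  finally have "x * \<beta> ^ k * inverse \<beta> ^ (l + n) \<in> periodic_sums \<beta> (s + (s + 1))" .
  hence "x * \<beta> ^ k * inverse \<beta> ^ (l + n) * inverse \<beta> ^ k \<in> periodic_sums \<beta> (s + (s + 1))"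
    by (rule periodic_sums_mult_inverse_power)
  moreover have "x * \<beta> ^ k * inverse \<beta> ^ (l + n) * inverse \<beta> ^ k = x * inverse \<beta> ^ (l + n)"
    using shift_k[of k "l + n"] by (simp add: power_add mult_ac)
  ultimately have "x * inverse \<beta> ^ (l + n) \<in> periodic_sums \<beta> (s + (s + 1))" by simp
  thus ?thesis by blast
qed

theorem theorem2p1:
  fixes \<beta> :: complex
  assumes "norm \<beta> > 1"
    and "Polynomial.algebraic \<beta>"
  shows "\<exists>\<A>. finite \<A> \<and> \<A> \<subseteq> \<int> \<and> Per \<A> \<beta> = rat_adjoin \<beta>"
proof -
  obtain f :: "int poly" where f: "f \<noteq> 0" "content f = 1" "poly (map_poly of_int f) \<beta> = 0"
    "\<And>g :: int poly. g \<noteq> 0 \<Longrightarrow> poly (map_poly of_int g) \<beta> = 0 \<Longrightarrow> degree f \<le> degree g"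
    using exists_minimal_int_poly[OF assms(2)] by blast
  define s where "s = (\<Sum>c\<leftarrow>coeffs f. \<bar>c\<bar>)"
  define \<A> :: "complex set" where "\<A> = of_int ` {- (s + (s + 1))..s + (s + 1)}"
  have "\<A> \<subseteq> \<int>" by (auto simp: \<A>_def)
  have "\<beta> \<noteq> 0" using assms by auto
  have "rat_adjoin \<beta> \<subseteq> Per \<A> \<beta>"
    unfolding \<A>_def s_def
    using rat_adjoin_imp_periodic_sums[OF assms(1) f] periodic_sums_imp_Per[OF _ \<open>\<beta> \<noteq> 0\<close>] by blast
  moreover have "Per \<A> \<beta> \<subseteq> rat_adjoin \<beta>"
    using assms(1) \<open>\<A> \<subseteq> \<int>\<close> by (rule Per_subset_rat_adjoin)
  moreover have "finite \<A>" by (simp add: \<A>_def)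
  ultimately show ?thesis using \<open>\<A> \<subseteq> \<int>\<close> by blast
qed

end
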